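(* Let $(x_1,y_1),\dots,(x_n,y_n)\in\mathbb{R}^2$ be distinct points, let $\lambda_1,\dots,\lambda_n>0$ and $\lambda_1',\dots,\lambda_n'>0$ be real numbers with $\sum_{i=1}^n\lambda_i=\sum_{i=1}^n\lambda_i'=1$, and set $\mu=\sum_{i=1}^n\lambda_i\,\delta(x_i,y_i)$ and $\nu=\sum_{i=1}^n\lambda_i'\,\delta(x_i,y_i)$. Then for every integer $k\ge 1$ and every $p\in\mathbb{R}_k[x,y]$, $p$ is a recursive relation for $M(\mu)(k)$ if and only if $p$ is a recursive relation for $M(\nu)(k)$.
   Context: $\delta(a,b)$ denotes the point-mass probability measure supported at $(a,b)\in\mathbb{R}^2$. The numbers $\lambda_i$ are called the densities of the atoms $(x_i,y_i)$ of $\mu$. $\mathbb{R}_k[x,y]$ is the space of real polynomials in $x,y$ of total degree at most $k$, with monomials listed in the order $1,x,y,x^2,xy,y^2,x^3,\dots,xy^{k-1},y^k$. For $p=\sum_{i+j\le k}a_{ij}x^iy^j$, $\hat p=(a_{ij})$ denotes the coefficient (column) vector of $p$ with respect to this ordered monomial basis. The moment matrix $M(\mu)(k)$ is the square matrix with rows and columns indexed by these monomials, whose entry in row $x^ay^b$ and column $x^cy^d$ is $\int x^{a+c}y^{b+d}\,d\mu$ (similarly for $\nu$). A polynomial $p\in\mathbb{R}_k[x,y]$ is a recursive relation for $M(\mu)(k)$ if $M(\mu)(k)\cdot\hat p=\boldsymbol 0$. *)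

theory Defs
  imports
    "HOL-Probability.Giry_Monad"
    "HOL-Computational_Algebra.Polynomial"
    "Jordan_Normal_Form.Matrix"
begin

text \<open>The monomials of total degree at most k in the order
  1, x, y, x^2, x y, y^2, ..., x y^(k-1), y^k; the pair (a, b) stands for x^a y^b.\<close>

definition monomials :: "nat \<Rightarrow> (nat \<times> nat) list" where
  "monomials k = concat (map (\<lambda>d. map (\<lambda>b. (d - b, b)) [0..<Suc d]) [0..<Suc k])"

text \<open>A polynomial in x and y is a polynomial in y whose coefficients are polynomials in x,
  so the coefficient of x^a y^b in p is \<open>coeff (coeff p b) a\<close>.\<close>

definition coeff_xy :: "real poly poly \<Rightarrow> nat \<Rightarrow> nat \<Rightarrow> real" where
  "coeff_xy p a b = coeff (coeff p b) a"

definition polys_upto :: "nat \<Rightarrow> real poly poly set" where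
  "polys_upto k = {p. \<forall>a b. coeff_xy p a b \<noteq> 0 \<longrightarrow> a + b \<le> k}"

definition coeff_vec :: "nat \<Rightarrow> real poly poly \<Rightarrow> real Matrix.vec" where
  "coeff_vec k p =
     Matrix.vec (length (monomials k)) (\<lambda>i. case monomials k ! i of (a, b) \<Rightarrow> coeff_xy p a b)"

definition moment_matrix :: "(real \<times> real) measure \<Rightarrow> nat \<Rightarrow> real Matrix.mat" where
  "moment_matrix M k =
     Matrix.mat (length (monomials k)) (length (monomials k))
       (\<lambda>(i, j). case (monomials k ! i, monomials k ! j) of
          ((a, b), (c, d)) \<Rightarrow> (\<integral>z. fst z ^ (a + c) * snd z ^ (b + d) \<partial>M))"

definition recursive_relation :: "real poly poly \<Rightarrow> (real \<times> real) measure \<Rightarrow> nat \<Rightarrow> bool" where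
  "recursive_relation p M k \<longleftrightarrow>
     p \<in> polys_upto k \<and>
     moment_matrix M k *\<^sub>v coeff_vec k p = 0\<^sub>v (length (monomials k))"

text \<open>The point mass at (a, b) is \<open>return borel (a, b)\<close>. The lemma \<open>emeasure_atomic_measure\<close>
  shows that the set function below is countably additive, so that \<open>measure_of\<close> does not
  collapse to the null measure.\<close>

definition atomic_measure ::
    "nat \<Rightarrow> (nat \<Rightarrow> real) \<Rightarrow> (nat \<Rightarrow> real) \<Rightarrow> (nat \<Rightarrow> real) \<Rightarrow> (real \<times> real) measure" where
  "atomic_measure n l x y =
     measure_of UNIV (sets borel)
       (\<lambda>A. \<Sum>i=1..n. ennreal (l i) * emeasure (return borel (x i, y i)) A)"

lemma sets_atomic_measure [simp, measurable_cong]: "sets (atomic_measure n l x y) = sets borel"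
  using sets.sets_measure_of_eq[of borel] by (simp add: atomic_measure_def)

lemma space_atomic_measure [simp]: "space (atomic_measure n l x y) = UNIV"
  using sets_eq_imp_space_eq[OF sets_atomic_measure] by simp

lemma emeasure_atomic_measure:
  assumes "A \<in> sets borel"
  shows "emeasure (atomic_measure n l x y) A =
           (\<Sum>i=1..n. ennreal (l i) * emeasure (return borel (x i, y i)) A)"
proof (rule emeasure_measure_of[OF atomic_measure_def])
  let ?f = "\<lambda>A. \<Sum>i=1..n. ennreal (l i) * emeasure (return borel (x i, y i)) A"
  show "positive (sets (atomic_measure n l x y)) ?f"
    by (simp add: positive_def)
  show "countably_additive (sets (atomic_measure n l x y)) ?f"
  proof (rule countably_additiveI)
    fix B :: "nat \<Rightarrow> (real \<times> real) set"
    assume B: "range B \<subseteq> sets (atomic_measure n l x y)" "disjoint_family B"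
    have "(\<Sum>k. ?f (B k)) =
        (\<Sum>i=1..n. \<Sum>k. ennreal (l i) * emeasure (return borel (x i, y i)) (B k))"
      by (rule suminf_sum) simp
    also have "\<dots> = ?f (\<Union>k. B k)"
    proof (rule sum.cong[OF refl])
      fix i
      have "range B \<subseteq> sets (return borel (x i, y i))"
        using B(1) by simp
      then have "(\<Sum>k. emeasure (return borel (x i, y i)) (B k)) =
          emeasure (return borel (x i, y i)) (\<Union>k. B k)"
        using B(2) by (rule suminf_emeasure)
      then show "(\<Sum>k. ennreal (l i) * emeasure (return borel (x i, y i)) (B k)) =
          ennreal (l i) * emeasure (return borel (x i, y i)) (\<Union>k. B k)"
        by (simp only: ennreal_suminf_cmult)
    qed
    finally show "(\<Sum>k. ?f (B k)) = ?f (\<Union>k. B k)" .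
  qed
  show "A \<in> sets (atomic_measure n l x y)"
    using assms by simp
qed simp

end

theory Submission
  imports Defs
begin

text \<open>The quadratic form of the moment matrix is
  $\hat p^T M(\mu)(k) \hat p = \sum_t \lambda_t\, p(x_t, y_t)^2$. As all densities are positive,
  the kernel of $M(\mu)(k)$ consists of the polynomials that vanish at every atom, a condition
  that does not involve the densities.\<close>

text \<open>The measure is concentrated on the finite set of atoms, so the integral reduces to a sum
  of values of \<open>f\<close> weighted by singleton masses. Distinctness ensures that the masses
  of different indices do not merge.\<close>

lemma integral_atomic_measure:
  fixes f :: "real \<times> real \<Rightarrow> real"
  assumes distinct: "inj_on (\<lambda>i. (x i, y i)) {1..n}"
    and nonneg: "\<And>i. i \<in> {1..n} \<Longrightarrow> l i \<ge> 0"
    and meas: "f \<in> borel_measurable borel"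
  shows "(\<integral>z. f z \<partial>atomic_measure n l x y) = (\<Sum>i=1..n. l i * f (x i, y i))"
proof -
  let ?M = "atomic_measure n l x y"
  define A where "A = (\<lambda>i. (x i, y i)) ` {1..n}"
  have A: "finite A" "A \<in> sets borel"
    by (auto simp: A_def intro!: borel_closed finite_imp_closed)
  have atom: "emeasure ?M {(x j, y j)} = ennreal (l j)" if j: "j \<in> {1..n}" for j
  proof -
    have "emeasure ?M {(x j, y j)} =
        (\<Sum>i=1..n. ennreal (l i) * emeasure (return borel (x i, y i)) {(x j, y j)})"
      by (rule emeasure_atomic_measure) simp
    also have "\<dots> = (\<Sum>i=1..n. if i = j then ennreal (l i) else 0)"
      using distinct j by (intro sum.cong) (auto simp: indicator_def dest: inj_onD)
    also have "\<dots> = ennreal (l j)"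
      using j by simp
    finally show ?thesis .
  qed
  have "emeasure ?M (- A) = (\<Sum>i=1..n. ennreal (l i) * emeasure (return borel (x i, y i)) (- A))"
    using A(2) by (intro emeasure_atomic_measure) auto
  also have "\<dots> = 0"
    using A(2) by (intro sum.neutral) (auto simp: A_def)
  finally have "AE z in ?M. z \<in> A"
    using A(2) by (intro AE_I[of _ _ "- A"]) auto
  \<comment> \<open>Off \<open>A\<close> the integrand may be set to zero; its support is then
    finite, which spares a separate integrability argument.\<close>
  then have "(\<integral>z. f z \<partial>?M) = (\<integral>z. f z * indicator A z \<partial>?M)"
    using meas A(2) by (intro integral_cong_AE) auto
  also have "\<dots> = (\<Sum>a\<in>A. f a * measure ?M {a})"
    using A(1) by (intro integral_indicator_finite_real) (auto simp: A_def atom)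
  also have "\<dots> = (\<Sum>i=1..n. f (x i, y i) * measure ?M {(x i, y i)})"
    unfolding A_def by (subst sum.reindex[OF distinct]) simp
  also have "\<dots> = (\<Sum>i=1..n. l i * f (x i, y i))"
    \<comment> \<open>\<open>ennreal\<close> truncates negative numbers to 0, so passing back from
      \<open>ennreal (l i)\<close> to \<open>l i\<close> relies on \<open>nonneg\<close>.\<close>
    by (intro sum.cong) (auto simp: measure_def atom nonneg)
  finally show ?thesis .
qed

text \<open>The matrix factors as V D V^T with V = (\<open>m i t\<close>) and D the diagonal matrix
  of the weights. Pairing its product with \<open>c\<close> against \<open>c\<close> itself gives a
  positively weighted sum of squares of the entries of V^T \<open>c\<close>.\<close>

lemma weighted_gram_kernel_iff:
  fixes l :: "'t \<Rightarrow> real" and m :: "'i \<Rightarrow> 't \<Rightarrow> real" and c :: "'i \<Rightarrow> real"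
  assumes "finite T" and pos: "\<And>t. t \<in> T \<Longrightarrow> l t > 0"
  shows "(\<forall>i\<in>I. (\<Sum>j\<in>I. (\<Sum>t\<in>T. l t * (m i t * m j t)) * c j) = 0) \<longleftrightarrow>
         (\<forall>t\<in>T. (\<Sum>j\<in>I. c j * m j t) = 0)"
proof -
  define q where "q t = (\<Sum>j\<in>I. c j * m j t)" for t
  \<comment> \<open>Each summand on the right carries the factor \<open>q t\<close>, so this already
    gives the direction from right to left.\<close>
  have row: "(\<Sum>j\<in>I. (\<Sum>t\<in>T. l t * (m i t * m j t)) * c j) = (\<Sum>t\<in>T. l t * m i t * q t)" for i
    unfolding q_def sum_distrib_left sum_distrib_right
    by (subst sum.swap) (simp add: algebra_simps)
  have "q t = 0" if zero: "\<forall>i\<in>I. (\<Sum>t\<in>T. l t * m i t * q t) = 0" and t: "t \<in> T" for t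
  proof -
    have "(\<Sum>t\<in>T. l t * (q t)\<^sup>2) = (\<Sum>t\<in>T. \<Sum>i\<in>I. c i * (l t * m i t * q t))"
      by (intro sum.cong)
        (auto simp: power2_eq_square q_def sum_distrib_left sum_distrib_right algebra_simps)
    also have "\<dots> = (\<Sum>i\<in>I. c i * (\<Sum>t\<in>T. l t * m i t * q t))"
      by (subst sum.swap) (simp add: sum_distrib_left)
    also have "\<dots> = 0"
      using zero by simp
    finally have "\<forall>t\<in>T. l t * (q t)\<^sup>2 = 0"
      using \<open>finite T\<close> pos by (subst (asm) sum_nonneg_eq_0_iff) (auto simp: less_imp_le)
    then show ?thesis
      using t pos[OF t] by auto
  qed
  then show ?thesis
    unfolding row q_def[symmetric] by auto
qed

text \<open>For \<open>p\<close> in \<open>polys_upto k\<close> the inner sum is the value of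
  \<open>p\<close> at the atom with index \<open>t\<close>, so \<open>l\<close> is absent from the
  right-hand side.\<close>

lemma recursive_relation_atomic_measure_iff:
  assumes distinct: "inj_on (\<lambda>i. (x i, y i)) {1..n}"
    and pos: "\<And>i. i \<in> {1..n} \<Longrightarrow> l i > 0"
  shows "recursive_relation p (atomic_measure n l x y) k \<longleftrightarrow>
    p \<in> polys_upto k \<and>
    (\<forall>t\<in>{1..n}. (\<Sum>j\<in>{0..<length (monomials k)}.
       case monomials k ! j of (a, b) \<Rightarrow> coeff_xy p a b * (x t ^ a * y t ^ b)) = 0)"
proof -
  let ?N = "length (monomials k)" and ?M = "atomic_measure n l x y"
  define m where "m j t = (case monomials k ! j of (a, b) \<Rightarrow> x t ^ a * y t ^ b)" for j t
  define c where "c j = (case monomials k ! j of (a, b) \<Rightarrow> coeff_xy p a b)" for j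
  \<comment> \<open>Splitting the exponents makes each moment a weighted Gram entry of monomial
    values at the atoms.\<close>
  have moment: "(\<integral>z. fst z ^ (a + c) * snd z ^ (b + d) \<partial>?M) =
      (\<Sum>t=1..n. l t * ((x t ^ a * y t ^ b) * (x t ^ c * y t ^ d)))" for a b c d
  proof -
    have "(\<lambda>z :: real \<times> real. fst z ^ (a + c) * snd z ^ (b + d)) \<in> borel_measurable borel"
      by (intro borel_measurable_continuous_onI continuous_intros)
    then show ?thesis
      using distinct pos
      by (subst integral_atomic_measure)
        (auto simp: power_add algebra_simps less_imp_le intro!: sum.cong)
  qed
  have entry: "(moment_matrix ?M k *\<^sub>v coeff_vec k p) $ i =
      (\<Sum>j\<in>{0..<?N}. (\<Sum>t=1..n. l t * (m i t * m j t)) * c j)" if "i < ?N" for i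
    using that
    by (auto simp: moment_matrix_def coeff_vec_def scalar_prod_def m_def c_def moment
        split: prod.splits intro!: sum.cong)
  have "moment_matrix ?M k *\<^sub>v coeff_vec k p = 0\<^sub>v ?N \<longleftrightarrow>
      (\<forall>i\<in>{0..<?N}. (\<Sum>j\<in>{0..<?N}. (\<Sum>t=1..n. l t * (m i t * m j t)) * c j) = 0)"
    \<comment> \<open>\<open>entry\<close> must fire while \<open>moment_matrix\<close> is still
      folded; unfolding it afterwards supplies the dimension.\<close>
    by (simp add: Matrix.vec_eq_iff entry) (auto simp: moment_matrix_def)
  also have "\<dots> \<longleftrightarrow> (\<forall>t\<in>{1..n}. (\<Sum>j\<in>{0..<?N}. c j * m j t) = 0)"
    using pos by (intro weighted_gram_kernel_iff) auto
  \<comment> \<open>An equality of functions, since \<open>t\<close> is bound by the quantifier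
    under which the sum is replaced.\<close>
  also have "(\<lambda>t. \<Sum>j\<in>{0..<?N}. c j * m j t) = (\<lambda>t. \<Sum>j\<in>{0..<?N}.
       case monomials k ! j of (a, b) \<Rightarrow> coeff_xy p a b * (x t ^ a * y t ^ b))"
    by (intro ext sum.cong) (auto simp: c_def m_def split: prod.splits)
  finally show ?thesis
    by (simp add: recursive_relation_def)
qed

theorem corollary3p5:
  fixes n k :: nat and x y l l' :: "nat \<Rightarrow> real" and \<mu> \<nu> :: "(real \<times> real) measure"
    and p :: "real poly poly"
  assumes distinct: "inj_on (\<lambda>i. (x i, y i)) {1..n}"
    and l_pos: "\<And>i. i \<in> {1..n} \<Longrightarrow> l i > 0"
    and l'_pos: "\<And>i. i \<in> {1..n} \<Longrightarrow> l' i > 0"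
    and l_sum: "(\<Sum>i=1..n. l i) = 1"
    and l'_sum: "(\<Sum>i=1..n. l' i) = 1"
    and mu: "\<mu> = atomic_measure n l x y"
    and nu: "\<nu> = atomic_measure n l' x y"
    and k: "k \<ge> 1"
    and p: "p \<in> polys_upto k"
  shows "recursive_relation p \<mu> k \<longleftrightarrow> recursive_relation p \<nu> k"
  unfolding mu nu
  using recursive_relation_atomic_measure_iff[where p = p and k = k, OF distinct l_pos]
    recursive_relation_atomic_measure_iff[where p = p and k = k, OF distinct l'_pos]
  by simp

end
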